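(* Let $P$ be a $k$-simple $d$-polytope with $1\le k\le d-1$. Then $P$ is inscribed if and only if all its $(d-k+1)$-dimensional faces are inscribed.
   Context: A $d$-polytope is $k$-simple if every $(d-k-1)$-dimensional face is contained in exactly $k+1$ facets. A polytope (or face) is inscribed if all its vertices lie on a common sphere. *)

theory Defs
  imports "HOL-Analysis.Analysis"
begin

definition inscribed :: "'a::euclidean_space set \<Rightarrow> bool" where
  "inscribed S \<longleftrightarrow> (\<exists>c r. \<forall>v. v extreme_point_of S \<longrightarrow> dist c v = r)"

definition k_simple :: "nat \<Rightarrow> 'a::euclidean_space set \<Rightarrow> bool" where
  "k_simple k P \<longleftrightarrow>
     (\<forall>F. F face_of P \<and> aff_dim F = aff_dim P - int k - 1 \<longrightarrow>
          card {G. G facet_of P \<and> F \<subseteq> G} = k + 1)"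

end

theory Submission
  imports Defs
begin

text \<open>A set of points lies on a sphere iff the squared norm agrees on it with an affine function, so
  the claim is about functions q on the vertices that are affine on certain faces. By induction
  on k it suffices to pass from the facets to P when every face of codimension 3 lies in at most three
  facets. Subtract an affine function so that q vanishes on a facet F, cut out by a linear
  functional l. On each facet G adjacent to F, q is then a multiple of l; if G and G' are adjacent
  to F along ridges of P sharing a common facet, then G and G' have a common vertex off F, so the two
  multiples agree. Since the boundary of F is connected through ridges, all multiples agree, and a
  further subtraction makes q vanish on F and on all its neighbours. This property propagates
  along ridges to all facets of P.\<close>

section \<open>Affine hulls and dimensions of faces\<close>

lemma inner_constant_on_affine_hull:
  fixes c :: "'a::euclidean_space"
  assumes "x \<in> affine hull S" "\<And>y. y \<in> S \<Longrightarrow> c \<bullet> y = b"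
  shows "c \<bullet> x = b"
proof -
  have "affine hull S \<subseteq> {y. c \<bullet> y = b}"
    by (rule hull_minimal) (use assms in \<open>auto simp: affine_hyperplane\<close>)
  then show ?thesis using assms by auto
qed

lemma affine_hull_eq_aff_dim:
  fixes S :: "'a::euclidean_space set"
  assumes "S \<subseteq> T" "aff_dim T \<le> aff_dim S"
  shows "affine hull S = affine hull T"
proof (cases "S = {}")
  case True
  then show ?thesis using assms
    by (metis aff_dim_empty aff_dim_geq antisym_conv)
next
  case False
  show ?thesis
    by (rule affine_dim_equal) (use False assms aff_dim_subset[of S T] in \<open>auto simp: hull_mono\<close>)
qed

lemma face_eq_aff_dim:
  fixes F :: "'a::euclidean_space set"
  assumes "convex P" "F face_of P" "G face_of P" "F \<subseteq> G" "aff_dim G \<le> aff_dim F"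
  shows "F = G"
proof (rule ccontr)
  assume "F \<noteq> G"
  moreover have "F face_of G"
    using assms by (meson face_of_imp_subset face_of_subset)
  ultimately show False
    using face_of_aff_dim_lt[of G F] assms face_of_imp_convex by force
qed

section \<open>Facets and ridges of a polyhedron\<close>

lemma facet_subset_eq:
  assumes "convex P" "F facet_of P" "G facet_of P" "F \<subseteq> G"
  shows "F = G"
  using assms face_eq_aff_dim[of P F G] by (auto simp: facet_of_def)

text \<open>\<open>F \<inter> G\<close> is a proper face of \<open>F\<close> containing
  \<open>R\<close>, and no proper face of \<open>F\<close> has larger dimension than the facet
  \<open>R\<close>.\<close>

lemma facet_Int_eq:
  assumes "convex P" "F facet_of P" "G facet_of P" "F \<noteq> G" "R facet_of F" "R \<subseteq> G"
  shows "F \<inter> G = R"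
proof -
  have F: "F face_of P" "G face_of P" "R face_of F" "R \<subseteq> F"
    using assms by (auto simp: facet_of_def face_of_imp_subset)
  have "convex F" using F face_of_imp_convex by blast
  have i: "F \<inter> G face_of F"
    using F by (meson face_of_Int face_of_face inf_le1)
  have "F \<inter> G \<noteq> F"
    using facet_subset_eq assms by blast
  then have "aff_dim (F \<inter> G) < aff_dim F"
    using face_of_aff_dim_lt \<open>convex F\<close> i by blast
  then have "aff_dim (F \<inter> G) \<le> aff_dim R"
    using assms by (auto simp: facet_of_def)
  then show ?thesis
    using face_eq_aff_dim[OF \<open>convex F\<close> F(3) i] F assms by blast
qed

text \<open>A proper nonempty face of a polyhedron is the intersection of the facets containing it;
  were \<open>F\<close> the only facet through \<open>R\<close>, then \<open>R\<close> would be all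
  of \<open>F\<close>.\<close>

lemma ridge_other_facet:
  assumes "polyhedron P" "F facet_of P" "R facet_of F"
  obtains G where "G facet_of P" "G \<noteq> F" "F \<inter> G = R"
proof -
  have F: "F face_of P" "R face_of F" "R \<noteq> {}" "convex P"
    using assms by (auto simp: facet_of_def polyhedron_imp_convex)
  then have RP: "R face_of P" by (meson face_of_trans)
  have "R \<noteq> P"
    using assms face_of_imp_subset[OF F(1)] face_of_imp_subset[OF F(2)]
    by (auto simp: facet_of_def)
  then have R: "R = \<Inter>{G. G facet_of P \<and> R \<subseteq> G}"
    using face_of_polyhedron[OF assms(1) RP F(3)] by blast
  have "R \<noteq> F" using assms(3) by auto
  have "\<exists>G. G facet_of P \<and> R \<subseteq> G \<and> G \<noteq> F"
  proof (rule ccontr)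
    assume "\<not> ?thesis"
    then have "{G. G facet_of P \<and> R \<subseteq> G} \<subseteq> {F}" by blast
    then have "F \<subseteq> R" by (subst R) blast
    then show False using \<open>R \<noteq> F\<close> face_of_imp_subset[OF F(2)] by blast
  qed
  then obtain G where G: "G facet_of P" "R \<subseteq> G" "G \<noteq> F" by blast
  then show thesis using that facet_Int_eq[OF F(4) assms(2) G(1) _ assms(3) G(2)] by metis
qed

text \<open>All facets have the same dimension, so a nonempty common face of codimension one in
  \<open>F\<close> has codimension one in \<open>G\<close>.\<close>

lemma ridge_facet_swap:
  assumes "F facet_of P" "G facet_of P" "F \<inter> G facet_of F"
  shows "F \<inter> G facet_of G"
proof -
  have "F \<inter> G face_of G"
    using assms unfolding facet_of_def by (meson face_of_Int face_of_face inf_le2)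
  then show ?thesis using assms by (auto simp: facet_of_def)
qed

text \<open>If f, g, h are points of the three facets outside the ridge, then h is an affine combination
  of the ridge, f and g, and the functionals cutting out the first two facets force both f and g to
  have positive coefficients; the functional cutting out the third facet is then nonzero at h.\<close>
lemma ridge_facets_unique:
  assumes P: "polyhedron P" and F: "F facet_of P" and G: "G facet_of P" and H: "H facet_of P"
    and R: "R facet_of F" and FG: "F \<inter> G = R" and FH: "F \<inter> H = R"
  shows "G = H"
proof (rule ccontr)
  assume "G \<noteq> H"
  have "convex P" using P polyhedron_imp_convex by blast
  have RG: "R facet_of G" using ridge_facet_swap F G R FG by blast
  have GH: "G \<inter> H = R"
    using facet_Int_eq[OF \<open>convex P\<close> G H \<open>G \<noteq> H\<close> RG] FH by blast
  have "\<not> F \<subseteq> R" "\<not> G \<subseteq> R"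
    using R RG by (metis facet_of_imp_subset facet_of_irrefl subset_antisym)+
  moreover have "\<not> H \<subseteq> R" using facet_subset_eq \<open>convex P\<close> \<open>G \<noteq> H\<close> G H FG GH by blast
  ultimately obtain f g h where f: "f \<in> F" "f \<notin> R" and g: "g \<in> G" "g \<notin> R" and h: "h \<in> H" "h \<notin> R"
    by blast
  have sub: "F \<subseteq> P" "G \<subseteq> P" "H \<subseteq> P" using F G H facet_of_imp_subset by auto
  obtain a1 b1 where 1: "P \<subseteq> {x. a1 \<bullet> x \<le> b1}" "F = P \<inter> {x. a1 \<bullet> x = b1}"
    using facet_of_polyhedron[OF P F] by metis
  obtain a2 b2 where 2: "P \<subseteq> {x. a2 \<bullet> x \<le> b2}" "G = P \<inter> {x. a2 \<bullet> x = b2}"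
    using facet_of_polyhedron[OF P G] by metis
  obtain a3 b3 where 3: "P \<subseteq> {x. a3 \<bullet> x \<le> b3}" "H = P \<inter> {x. a3 \<bullet> x = b3}"
    using facet_of_polyhedron[OF P H] by metis
  have onR: "a1 \<bullet> y = b1" "a2 \<bullet> y = b2" "a3 \<bullet> y = b3" if "y \<in> R" for y
    using that 1 2 3 FG FH by auto
  have f0: "a1 \<bullet> f = b1" and g0: "a2 \<bullet> g = b2" and h0: "a3 \<bullet> h = b3"
    using f g h 1 2 3 by auto
  have "f \<notin> G" "f \<notin> H" "g \<notin> F" "g \<notin> H" "h \<notin> F" "h \<notin> G"
    using FG FH GH f g h by auto
  moreover have "f \<in> P" "g \<in> P" "h \<in> P" using sub f g h by auto
  ultimately have pos: "a2 \<bullet> f < b2" "a3 \<bullet> f < b3" "a1 \<bullet> g < b1" "a3 \<bullet> g < b3" "a1 \<bullet> h < b1" "a2 \<bullet> h < b2"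
    using 1 2 3 by (auto simp: less_le)
  have "f \<notin> affine hull R"
    using inner_constant_on_affine_hull[of f R a2 b2] onR pos by fastforce
  moreover have "g \<notin> affine hull (insert f R)"
    using inner_constant_on_affine_hull[of g "insert f R" a1 b1] onR pos f0 by fastforce
  ultimately have "aff_dim (insert g (insert f R)) = aff_dim R + 2"
    by (simp add: aff_dim_insert)
  then have "affine hull (insert g (insert f R)) = affine hull P"
    using F R sub f g \<open>f \<in> P\<close> \<open>g \<in> P\<close> FG
    by (intro affine_hull_eq_aff_dim) (auto simp: facet_of_def)
  then have hin: "h \<in> affine hull (insert g (insert f R))"
    using \<open>h \<in> P\<close> by (simp add: hull_inc)
  \<comment> \<open>With these coefficients \<open>a3 - p *\<^sub>R a1 - q *\<^sub>R a2\<close> is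
    constant on \<open>R\<close>, \<open>f\<close> and \<open>g\<close>: at \<open>g\<close> only
    the slack of \<open>a1\<close> survives, at \<open>f\<close> only that of
    \<open>a2\<close>.\<close>
  define p where "p = (b3 - a3 \<bullet> g) / (b1 - a1 \<bullet> g)"
  define q where "q = (b3 - a3 \<bullet> f) / (b2 - a2 \<bullet> f)"
  have pq: "p > 0" "q > 0" using pos by (auto simp: p_def q_def)
  have pg: "p * (b1 - a1 \<bullet> g) = b3 - a3 \<bullet> g" and qf: "q * (b2 - a2 \<bullet> f) = b3 - a3 \<bullet> f"
    using pos by (auto simp: p_def q_def)
  have "(a3 - p *\<^sub>R a1 - q *\<^sub>R a2) \<bullet> h = b3 - p * b1 - q * b2"
    by (rule inner_constant_on_affine_hull[OF hin])
      (use pg qf onR f0 g0 in \<open>auto simp: inner_diff_left algebra_simps\<close>)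
  then have "p * (b1 - a1 \<bullet> h) + q * (b2 - a2 \<bullet> h) = 0"
    using h0 by (simp add: inner_diff_left algebra_simps)
  moreover have "p * (b1 - a1 \<bullet> h) > 0" "q * (b2 - a2 \<bullet> h) > 0" using pq pos by auto
  ultimately show False by linarith
qed

section \<open>Connectedness of the facets through ridges\<close>

text \<open>On the segment from a relative interior point of \<open>F\<close> to an outside
  \<open>x\<close>, the exit point lies on a ridge. The slack of the neighbour across that ridge is
  positive at the start and zero at the exit, hence negative at \<open>x\<close>.\<close>

lemma facet_mem_if_adjacent_halfspaces:
  assumes P: "polytope P" and F: "F facet_of P" and x: "x \<in> affine hull F"
    and adj: "\<And>G. G facet_of P \<Longrightarrow> F \<inter> G facet_of F \<Longrightarrow>
        \<exists>a b. P \<subseteq> {y. a \<bullet> y \<le> b} \<and> G = P \<inter> {y. a \<bullet> y = b} \<and> a \<bullet> x \<le> b"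
  shows "x \<in> F"
proof (rule ccontr)
  assume "x \<notin> F"
  have Fp: "polytope F" "F \<noteq> {}"
    using P F face_of_polytope_polytope by (auto simp: facet_of_def)
  then have Fc: "convex F" "bounded F" "polyhedron F"
    by (auto simp: polytope_imp_convex polytope_imp_bounded polytope_imp_polyhedron)
  then obtain p where p: "p \<in> rel_interior F"
    using Fp rel_interior_eq_empty by blast
  have "p \<in> F" using p rel_interior_subset by blast
  then have "p \<noteq> x" using \<open>x \<notin> F\<close> by auto
  obtain d where d: "0 < d" "p + d *\<^sub>R (x - p) \<in> rel_frontier F"
    and di: "\<And>e. \<lbrakk>0 \<le> e; e < d\<rbrakk> \<Longrightarrow> (p + e *\<^sub>R (x - p)) \<in> rel_interior F"
    by (rule ray_to_rel_frontier[OF Fc(2) p, of "x - p"]) (use x \<open>p \<noteq> x\<close> in auto)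
  let ?y = "p + d *\<^sub>R (x - p)"
  obtain R where R: "R facet_of F" "?y \<in> R"
    using d rel_frontier_of_polyhedron[OF Fc(3)] by auto
  have yF: "?y \<in> F" using R facet_of_imp_subset by blast
  \<comment> \<open>The point \<open>x\<close> has parameter 1, so the relative boundary is met
    strictly before it.\<close>
  have "d < 1"
  proof (rule ccontr)
    assume "\<not> d < 1"
    moreover have "d \<noteq> 1" using yF \<open>x \<notin> F\<close> by auto
    ultimately have "p + 1 *\<^sub>R (x - p) \<in> rel_interior F" using di[of 1] by auto
    then show False using \<open>x \<notin> F\<close> rel_interior_subset by auto
  qed
  obtain G where G: "G facet_of P" "G \<noteq> F" "F \<inter> G = R"
    using ridge_other_facet[OF polytope_imp_polyhedron[OF P] F R(1)] .
  then obtain a b where ab: "P \<subseteq> {y. a \<bullet> y \<le> b}" "G = P \<inter> {y. a \<bullet> y = b}" "a \<bullet> x \<le> b"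
    using adj[of G] R by metis
  have "p \<notin> R"
    using face_of_disjoint_rel_interior[of R F] R p facet_of_irrefl facet_of_imp_face_of by blast
  then have "p \<notin> G" using G \<open>p \<in> F\<close> by auto
  then have "a \<bullet> p < b"
    using ab \<open>p \<in> F\<close> facet_of_imp_subset[OF F] by (auto simp: less_le)
  moreover have "a \<bullet> ?y = b" using R G ab by auto
  then have "(1 - d) * (b - a \<bullet> p) + d * (b - a \<bullet> x) = 0"
    by (simp add: inner_add_right inner_diff_right algebra_simps)
  moreover have "d * (b - a \<bullet> x) \<ge> 0" using ab d by auto
  moreover have "(1 - d) * (b - a \<bullet> p) > 0" using \<open>d < 1\<close> \<open>a \<bullet> p < b\<close> by auto
  ultimately show False by linarith
qed

text \<open>Here \<open>\<alpha> h + t * \<sigma> h\<close> is the value of a functional at time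
  \<open>t\<close> along a ray and \<open>\<beta> h\<close> its bound; the rising functional that
  meets its bound first determines \<open>t\<close>.\<close>

lemma ray_leaves_halfspaces:
  fixes \<alpha> \<beta> \<sigma> :: "'h \<Rightarrow> real"
  assumes "finite H" "\<And>h. h \<in> H \<Longrightarrow> \<alpha> h \<le> \<beta> h" "\<exists>h\<in>H. \<sigma> h > 0"
  obtains t h0 where "t \<ge> 0" "h0 \<in> H" "\<alpha> h0 + t * \<sigma> h0 = \<beta> h0" "\<And>h. h \<in> H \<Longrightarrow> \<alpha> h + t * \<sigma> h \<le> \<beta> h"
proof -
  define r where "r = (\<lambda>h. (\<beta> h - \<alpha> h) / \<sigma> h)"
  have "finite {h \<in> H. \<sigma> h > 0}" "{h \<in> H. \<sigma> h > 0} \<noteq> {}" using assms by auto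
  from ex_min_if_finite[OF finite_imageI[OF this(1), of r]] this(2)
  obtain h0 where h0: "h0 \<in> H" "\<sigma> h0 > 0" and min: "\<And>h. h \<in> H \<Longrightarrow> \<sigma> h > 0 \<Longrightarrow> r h0 \<le> r h"
    by (force simp: not_less)
  have r0: "r h0 \<ge> 0" using h0 assms(2) by (auto simp: r_def)
  show thesis
  proof (rule that[OF r0 h0(1)])
    show "\<alpha> h0 + r h0 * \<sigma> h0 = \<beta> h0" using h0 by (simp add: r_def)
    show "\<alpha> h + r h0 * \<sigma> h \<le> \<beta> h" if h: "h \<in> H" for h
    proof (cases "\<sigma> h > 0")
      case True
      then show ?thesis using min[OF h True] by (simp add: r_def field_simps)
    next
      case False
      then have "r h0 * \<sigma> h \<le> 0" using r0 by (simp add: mult_nonneg_nonpos)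
      then show ?thesis using assms(2)[OF h] by linarith
    qed
  qed
qed

text \<open>The halfspaces belonging to a set W of facets closed under adjacency already cut out P:
  each hyperplane of W meets their intersection Q in a facet of P, and through any point of Q there
  is a line parallel to such a facet, which leaves Q on both sides through facets of P.\<close>
lemma facets_connected:
  assumes P: "polytope P" and dim: "2 \<le> aff_dim P"
    and W: "W \<noteq> {}" "\<And>F. F \<in> W \<Longrightarrow> F facet_of P"
    and closed: "\<And>F G. F \<in> W \<Longrightarrow> G facet_of P \<Longrightarrow> F \<inter> G facet_of F \<Longrightarrow> G \<in> W"
    and G: "G facet_of P"
  shows "G \<in> W"
proof -
  \<comment> \<open>Minimality makes the facets of \<open>P\<close> exactly the sections
    \<open>fac h\<close>, and at the end excludes a proper subfamily of \<open>\<H>\<close>.\<close>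
  obtain \<H> where fin: "finite \<H>" and seq: "P = affine hull P \<inter> \<Inter>\<H>"
    and faces: "\<And>h. h \<in> \<H> \<Longrightarrow> \<exists>a b. a \<noteq> 0 \<and> h = {x. a \<bullet> x \<le> b}"
    and min: "\<And>\<H>'. \<H>' \<subset> \<H> \<Longrightarrow> P \<subset> affine hull P \<inter> \<Inter>\<H>'"
    using polytope_imp_polyhedron[OF P] unfolding polyhedron_Int_affine_minimal by meson
  then obtain a b where ab: "\<And>h. h \<in> \<H> \<Longrightarrow> a h \<noteq> 0 \<and> h = {x. a h \<bullet> x \<le> b h}"
    by metis
  define fac where "fac h = P \<inter> {x. a h \<bullet> x = b h}" for h
  have fac: "C facet_of P \<longleftrightarrow> (\<exists>h\<in>\<H>. C = fac h)" for C
    using facet_of_polyhedron_explicit[OF fin seq ab min] by (auto simp: fac_def)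
  define \<K> where "\<K> = {h \<in> \<H>. fac h \<in> W}"
  have \<K>: "finite \<K>" "\<K> \<subseteq> \<H>" using fin by (auto simp: \<K>_def)
  have sub: "P \<subseteq> {x. a h \<bullet> x \<le> b h}" if "h \<in> \<H>" for h using seq ab that by blast
  \<comment> \<open>Closure of \<open>W\<close> puts every neighbour of \<open>fac k\<close> among
    the facets from \<open>\<K>\<close>, so the halfspaces of \<open>\<K>\<close> alone confine
    \<open>x\<close> to the facet.\<close>
  have key: "x \<in> fac k" if k: "k \<in> \<K>" and x: "x \<in> affine hull (fac k)"
      and le: "\<And>h. h \<in> \<K> \<Longrightarrow> a h \<bullet> x \<le> b h" for k x
  proof (rule facet_mem_if_adjacent_halfspaces[OF P _ x])
    show "fac k facet_of P" using k W by (auto simp: \<K>_def)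
    fix G assume G: "G facet_of P" "fac k \<inter> G facet_of fac k"
    then have "G \<in> W" using closed k by (auto simp: \<K>_def)
    moreover obtain h where "h \<in> \<H>" "G = fac h" using fac G by auto
    ultimately have "h \<in> \<K>" "G = fac h" by (auto simp: \<K>_def)
    then show "\<exists>a b. P \<subseteq> {y. a \<bullet> y \<le> b} \<and> G = P \<inter> {y. a \<bullet> y = b} \<and> a \<bullet> x \<le> b"
      using sub[of h] le[of h] \<K> unfolding fac_def by blast
  qed
  have aff_fac: "x \<in> affine hull (fac k)"
    if "k \<in> \<H>" "x \<in> affine hull P" "a k \<bullet> x = b k" for x k
  proof -
    have fk: "fac k facet_of P" using fac that by blast
    then have fk': "fac k \<noteq> {}" "aff_dim (fac k) = aff_dim P - 1" by (auto simp: facet_of_def)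
    have ne: "\<not> affine hull P \<subseteq> {x. a k \<bullet> x = b k}"
    proof
      assume "affine hull P \<subseteq> {x. a k \<bullet> x = b k}"
      then have "fac k = P" unfolding fac_def using hull_subset[of P affine] by blast
      then show False using fk by simp
    qed
    \<comment> \<open>Both sides have dimension \<open>aff_dim P - 1\<close>, since the hyperplane
      does not contain \<open>affine hull P\<close>.\<close>
    have "affine hull (fac k) = affine hull P \<inter> {x. a k \<bullet> x = b k}"
    proof (rule affine_dim_equal)
      show "affine hull fac k \<subseteq> affine hull P \<inter> {x. a k \<bullet> x = b k}"
        by (rule hull_minimal)
          (auto simp: fac_def hull_inc affine_Int affine_hyperplane)
      show "aff_dim (affine hull fac k) = aff_dim (affine hull P \<inter> {x. a k \<bullet> x = b k})"
        using fk' ne that aff_dim_affine_Int_hyperplane[of "affine hull P" "a k" "b k"] by auto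
    qed (use fk' in \<open>auto simp: affine_Int affine_hyperplane\<close>)
    then show ?thesis using that by blast
  qed
  obtain F where F: "F \<in> W" using W by blast
  then have Ff: "F facet_of P" using W by auto
  then obtain k where k: "k \<in> \<K>" "F = fac k" using fac F by (auto simp: \<K>_def)
  \<comment> \<open>Dimension at least 2 enters here: the facet is not a single point and supplies a
    direction \<open>v\<close> parallel to it.\<close>
  have "aff_dim F \<ge> 1" using Ff dim by (auto simp: facet_of_def)
  then have "F \<noteq> {}" by auto
  then obtain x0 where x0: "x0 \<in> F" by blast
  have "\<not> F \<subseteq> {x0}"
    using aff_dim_subset[of F "{x0}"] \<open>aff_dim F \<ge> 1\<close> by auto
  then obtain x1 where x01: "x0 \<in> F" "x1 \<in> F" "x0 \<noteq> x1" using x0 by blast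
  define v where "v = x1 - x0"
  have line: "x0 + t *\<^sub>R v \<in> affine hull F" for t
  proof -
    have "(1 - t) *\<^sub>R x0 + t *\<^sub>R x1 \<in> affine hull F"
      by (rule mem_affine) (use x01 in \<open>auto simp: hull_inc\<close>)
    then show ?thesis by (simp add: v_def algebra_simps)
  qed
  \<comment> \<open>Otherwise no halfspace of \<open>\<K>\<close> stops the ray from
    \<open>x0\<close> along \<open>w\<close>, and the whole ray stays in the bounded set
    \<open>F\<close>.\<close>
  have rise: "\<exists>h\<in>\<K>. a h \<bullet> w > 0" if w: "w = v \<or> w = - v" for w
  proof (rule ccontr)
    assume "\<not> ?thesis"
    then have np: "\<And>h. h \<in> \<K> \<Longrightarrow> a h \<bullet> w \<le> 0" by force
    have inF: "x0 + t *\<^sub>R w \<in> F" if "t \<ge> 0" for t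
      unfolding k(2)
    proof (rule key[OF k(1)])
      show "x0 + t *\<^sub>R w \<in> affine hull fac k" using w line[of t] line[of "-t"] k by auto
      fix h assume h: "h \<in> \<K>"
      have "a h \<bullet> x0 \<le> b h" using sub[of h] h \<K> x01 facet_of_imp_subset[OF Ff] by blast
      moreover have "t * (a h \<bullet> w) \<le> 0" using np[OF h] that by (simp add: mult_nonneg_nonpos)
      ultimately show "a h \<bullet> (x0 + t *\<^sub>R w) \<le> b h" by (simp add: inner_add_right)
    qed
    have "bounded F"
      using P Ff bounded_subset facet_of_imp_subset polytope_imp_bounded by blast
    then obtain B where B: "\<And>y. y \<in> F \<Longrightarrow> norm y \<le> B" unfolding bounded_iff by blast
    have "norm w > 0" using w x01 by (auto simp: v_def)
    \<comment> \<open>Far enough that \<open>x0 + t *\<^sub>R w\<close> has norm at least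
      \<open>\<bar>B\<bar> + 1\<close>.\<close>
    define t where "t = (\<bar>B\<bar> + norm x0 + 1) / norm w"
    have "t \<ge> 0" by (simp add: t_def)
    have "norm (t *\<^sub>R w) = \<bar>B\<bar> + norm x0 + 1" using \<open>norm w > 0\<close> by (simp add: t_def)
    moreover have "norm (t *\<^sub>R w) \<le> norm (x0 + t *\<^sub>R w) + norm x0"
      using norm_triangle_ineq4[of "x0 + t *\<^sub>R w" x0] by simp
    ultimately show False using B[OF inF[OF \<open>t \<ge> 0\<close>]] by linarith
  qed
  \<comment> \<open>The first halfspace of \<open>\<K>\<close> to become tight along the ray gives a
    point that \<open>key\<close> places in a facet of \<open>P\<close>.\<close>
  have exit: "\<exists>t\<ge>0. z + t *\<^sub>R w \<in> P"
    if w: "w = v \<or> w = - v" and z: "z \<in> affine hull P \<inter> \<Inter>\<K>" for w z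
  proof -
    have zle: "a h \<bullet> z \<le> b h" if "h \<in> \<K>" for h using z ab that \<K> by blast
    obtain t h where t: "t \<ge> 0" "h \<in> \<K>" "a h \<bullet> z + t * (a h \<bullet> w) = b h"
      and tle: "\<And>h. h \<in> \<K> \<Longrightarrow> a h \<bullet> z + t * (a h \<bullet> w) \<le> b h"
      using ray_leaves_halfspaces[OF \<K>(1), of "\<lambda>h. a h \<bullet> z" b "\<lambda>h. a h \<bullet> w"] zle rise[OF w]
      by blast
    have "x0 \<in> affine hull P" "x1 \<in> affine hull P"
      using x01 facet_of_imp_subset[OF Ff] by (auto simp: hull_inc)
    then have aff: "z + s *\<^sub>R v \<in> affine hull P" for s
      unfolding v_def using z mem_affine_3_minus[of "affine hull P" z x1 x0 s] by auto
    have "z + t *\<^sub>R w \<in> fac h"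
    proof (rule key[OF t(2)])
      have "z + t *\<^sub>R w \<in> affine hull P" using aff[of t] aff[of "-t"] w by auto
      then show "z + t *\<^sub>R w \<in> affine hull fac h"
        using aff_fac[of h] t \<K> by (auto simp: inner_add_right)
    qed (use tle in \<open>auto simp: inner_add_right\<close>)
    then show ?thesis using t by (auto simp: fac_def)
  qed
  have "affine hull P \<inter> \<Inter>\<K> \<subseteq> P"
  proof
    fix z assume z: "z \<in> affine hull P \<inter> \<Inter>\<K>"
    obtain s where s: "s \<ge> 0" "z + s *\<^sub>R v \<in> P" using exit[OF _ z] by blast
    obtain t where t: "t \<ge> 0" "z - t *\<^sub>R v \<in> P" using exit[OF _ z, of "-v"] by auto
    show "z \<in> P"
    proof (cases "s + t = 0")
      case True
      then have "s = 0" using s t by linarith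
      then show ?thesis using s by auto
    next
      case False
      then have st: "s + t > 0" using s t by linarith
      \<comment> \<open>The weights make the two displacements along \<open>v\<close> cancel, so
        \<open>z\<close> lies between its two exit points.\<close>
      have "(t / (s + t)) *\<^sub>R (z + s *\<^sub>R v) + (s / (s + t)) *\<^sub>R (z - t *\<^sub>R v) \<in> P"
        by (rule convexD[OF polytope_imp_convex[OF P] s(2) t(2)])
          (use s t st in \<open>auto simp: field_simps add_divide_distrib[symmetric]\<close>)
      also have "(t / (s + t)) *\<^sub>R (z + s *\<^sub>R v) + (s / (s + t)) *\<^sub>R (z - t *\<^sub>R v)
          = (t / (s + t) + s / (s + t)) *\<^sub>R z"
        by (simp add: algebra_simps)
      also have "t / (s + t) + s / (s + t) = 1"
        using st by (simp add: add_divide_distrib[symmetric] add.commute)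
      also have "1 *\<^sub>R z = z" by simp
      finally show ?thesis .
    qed
  qed
  then have "\<K> = \<H>" using min[of \<K>] \<K> by blast
  then show ?thesis using fac G by (auto simp: \<K>_def)
qed

section \<open>Spheres as affine conditions on vertices\<close>

text \<open>The function is arbitrary rather than the squared norm because later steps subtract
  affine functions to make it vanish on chosen facets.\<close>

definition affine_on_vertices :: "('a::euclidean_space \<Rightarrow> real) \<Rightarrow> 'a set \<Rightarrow> bool" where
  "affine_on_vertices q S \<longleftrightarrow> (\<exists>c b. \<forall>v. v extreme_point_of S \<longrightarrow> q v = c \<bullet> v + b)"

text \<open>Expanding the squared distance to the centre leaves an affine function of
  \<open>v\<close>; conversely, completing the square puts the centre at half the gradient
  \<open>c\<close>.\<close>

lemma inscribed_iff_affine_on_vertices: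
  "inscribed S \<longleftrightarrow> affine_on_vertices (\<lambda>v. v \<bullet> v) S"
proof
  assume "inscribed S"
  then obtain c r where c: "\<And>v. v extreme_point_of S \<Longrightarrow> dist c v = r"
    unfolding inscribed_def by blast
  have "v \<bullet> v = (2 *\<^sub>R c) \<bullet> v + (r\<^sup>2 - c \<bullet> c)" if "v extreme_point_of S" for v
    using c[OF that]
    by (auto simp: dist_norm power2_norm_eq_inner inner_diff_left inner_diff_right inner_commute)
  then show "affine_on_vertices (\<lambda>v. v \<bullet> v) S" unfolding affine_on_vertices_def by blast
next
  assume "affine_on_vertices (\<lambda>v. v \<bullet> v) S"
  then obtain c b where c: "\<And>v. v extreme_point_of S \<Longrightarrow> v \<bullet> v = c \<bullet> v + b"
    unfolding affine_on_vertices_def by blast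
  have "dist ((1/2) *\<^sub>R c) v = sqrt (c \<bullet> c / 4 + b)" if "v extreme_point_of S" for v
    unfolding dist_norm norm_eq_sqrt_inner
    using c[OF that] by (simp add: inner_diff_left inner_diff_right inner_commute field_simps)
  then show "inscribed S" unfolding inscribed_def by blast
qed

lemma affine_on_vertices_face:
  assumes "F face_of S" "affine_on_vertices q S"
  shows "affine_on_vertices q F"
  using assms unfolding affine_on_vertices_def by (meson extreme_point_of_face)

lemma affine_on_vertices_diff:
  assumes "affine_on_vertices q S"
  shows "affine_on_vertices (\<lambda>v. q v - (c \<bullet> v + b)) S"
proof -
  obtain c' b' where "\<And>v. v extreme_point_of S \<Longrightarrow> q v = c' \<bullet> v + b'"
    using assms unfolding affine_on_vertices_def by blast
  then have "\<And>v. v extreme_point_of S \<Longrightarrow> q v - (c \<bullet> v + b) = (c' - c) \<bullet> v + (b' - b)"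
    by (simp add: inner_diff_left)
  then show ?thesis unfolding affine_on_vertices_def by blast
qed

lemma polytope_subset_if_vertices:
  fixes P :: "'a::euclidean_space set"
  assumes "polytope P" "convex H" "\<And>v. v extreme_point_of P \<Longrightarrow> v \<in> H"
  shows "P \<subseteq> H"
proof -
  have "P = convex hull {v. v extreme_point_of P}"
    using assms(1) by (intro Krein_Milman_Minkowski polytope_imp_compact polytope_imp_convex)
  also have "\<dots> \<subseteq> H" by (rule hull_minimal) (use assms in auto)
  finally show ?thesis .
qed

text \<open>The affine function representing \<open>q\<close> on \<open>G\<close> and the function
  \<open>b - a \<bullet> v\<close> both vanish on the ridge. The ridge and one point
  \<open>w\<close> of \<open>G\<close> off \<open>F\<close> span \<open>affine hull G\<close>, so
  the ratio at \<open>w\<close> is the ratio everywhere.\<close>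

lemma adjacent_multiple:
  assumes P: "polytope P" and F: "F facet_of P" and G: "G facet_of P" and FG: "F \<inter> G facet_of F"
    and a: "F = P \<inter> {x. a \<bullet> x = b}" and q0: "\<And>v. v extreme_point_of F \<Longrightarrow> q v = 0"
    and q: "affine_on_vertices q G"
  shows "\<exists>t. \<forall>v. v extreme_point_of G \<longrightarrow> q v = t * (b - a \<bullet> v)"
proof -
  have RG: "F \<inter> G facet_of G" using ridge_facet_swap F G FG by blast
  have pG: "polytope G" "polytope (F \<inter> G)"
    using P F G face_of_polytope_polytope facet_of_imp_face_of face_of_Int by metis+
  obtain c e where ce: "\<And>v. v extreme_point_of G \<Longrightarrow> q v = c \<bullet> v + e"
    using q unfolding affine_on_vertices_def by blast
  have R0: "F \<inter> G \<subseteq> {x. c \<bullet> x = - e}"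
  proof (rule polytope_subset_if_vertices[OF pG(2) convex_hyperplane])
    fix v assume "v extreme_point_of F \<inter> G"
    then have "v extreme_point_of F" "v extreme_point_of G"
      using extreme_point_of_face FG RG facet_of_imp_face_of by blast+
    then show "v \<in> {x. c \<bullet> x = - e}" using ce q0 by force
  qed
  have "\<not> G \<subseteq> F" using RG by (metis facet_of_irrefl inf.absorb2)
  then obtain w where w: "w \<in> G" "w \<notin> F" by blast
  have sub: "G \<subseteq> P" using G facet_of_imp_subset by blast
  then have aw: "b - a \<bullet> w \<noteq> 0" using w a by auto
  define t where "t = (c \<bullet> w + e) / (b - a \<bullet> w)"
  have tw: "t * (b - a \<bullet> w) = c \<bullet> w + e" using aw by (simp add: t_def)
  have ab: "a \<bullet> y = b" if "y \<in> F \<inter> G" for y using that a by blast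
  have "w \<notin> affine hull (F \<inter> G)"
    using inner_constant_on_affine_hull[of w "F \<inter> G" a b, OF _ ab] aw by fastforce
  then have "aff_dim (insert w (F \<inter> G)) = aff_dim G"
    using RG by (simp add: aff_dim_insert facet_of_def)
  then have "affine hull (insert w (F \<inter> G)) = affine hull G"
    using w(1) by (intro affine_hull_eq_aff_dim) auto
  then have hull: "v \<in> affine hull (insert w (F \<inter> G))" if "v \<in> G" for v
    using that by (simp add: hull_inc)
  have "q v = t * (b - a \<bullet> v)" if v: "v extreme_point_of G" for v
  proof -
    have "v \<in> G" using v by (simp add: extreme_point_of_def)
    have "(c + t *\<^sub>R a) \<bullet> v = t * b - e"
      by (rule inner_constant_on_affine_hull[OF hull[OF \<open>v \<in> G\<close>]])
        (use tw R0 ab in \<open>auto simp: inner_add_left algebra_simps\<close>)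
    then show ?thesis using ce[OF v] by (simp add: inner_add_left algebra_simps)
  qed
  then show ?thesis by blast
qed

section \<open>Bounds on the number of facets through a face\<close>

text \<open>Only the upper bound on the number of facets is needed, and, unlike k-simplicity, it passes
  to facets and to smaller k without any counting from below.\<close>
definition at_most_k_simple :: "nat \<Rightarrow> 'a::euclidean_space set \<Rightarrow> bool" where
  "at_most_k_simple k P \<longleftrightarrow>
     (\<forall>E. E face_of P \<and> E \<noteq> {} \<and> aff_dim E = aff_dim P - int k - 1 \<longrightarrow>
          card {G. G facet_of P \<and> E \<subseteq> G} \<le> k + 1)"

text \<open>Every facet of \<open>F\<close> through \<open>E\<close> is \<open>F \<inter> G\<close>
  for a facet \<open>G \<noteq> F\<close> of \<open>P\<close> through \<open>E\<close>; leaving out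
  \<open>F\<close> itself lowers the bound by one.\<close>

lemma at_most_k_simple_facet:
  assumes P: "polytope P" and s: "at_most_k_simple (Suc k) P" and F: "F facet_of P"
  shows "at_most_k_simple k F"
  unfolding at_most_k_simple_def
proof (intro allI impI, elim conjE)
  fix E assume E: "E face_of F" "E \<noteq> {}" "aff_dim E = aff_dim F - int k - 1"
  have "E face_of P" using E F face_of_trans facet_of_imp_face_of by blast
  moreover have "aff_dim E = aff_dim P - int (Suc k) - 1" using E F by (auto simp: facet_of_def)
  ultimately have c: "card {G. G facet_of P \<and> E \<subseteq> G} \<le> Suc k + 1"
    using s E unfolding at_most_k_simple_def by blast
  have fin: "finite {G. G facet_of P \<and> E \<subseteq> G}"
    using finite_polytope_facets[OF P] by (rule rev_finite_subset) auto
  have Fin: "F \<in> {G. G facet_of P \<and> E \<subseteq> G}" using F E face_of_imp_subset by blast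
  have "{R. R facet_of F \<and> E \<subseteq> R} \<subseteq> (\<lambda>G. F \<inter> G) ` ({G. G facet_of P \<and> E \<subseteq> G} - {F})"
  proof
    fix R assume "R \<in> {R. R facet_of F \<and> E \<subseteq> R}"
    then have R: "R facet_of F" "E \<subseteq> R" by auto
    obtain G where "G facet_of P" "G \<noteq> F" "F \<inter> G = R"
      using ridge_other_facet[OF polytope_imp_polyhedron[OF P] F R(1)] .
    then show "R \<in> (\<lambda>G. F \<inter> G) ` ({G. G facet_of P \<and> E \<subseteq> G} - {F})" using R by blast
  qed
  then have "card {R. R facet_of F \<and> E \<subseteq> R} \<le> card ({G. G facet_of P \<and> E \<subseteq> G} - {F})"
    using fin by (meson surj_card_le finite_Diff)
  also have "\<dots> = card {G. G facet_of P \<and> E \<subseteq> G} - 1" using Fin fin by simp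
  finally show "card {G. G facet_of F \<and> E \<subseteq> G} \<le> k + 1" using c by linarith
qed

text \<open>A face of dimension one more lies in strictly fewer facets.\<close>
lemma at_most_k_simple_pred:
  assumes P: "polytope P" and s: "at_most_k_simple (Suc k) P" and d: "int k + 2 \<le> aff_dim P"
  shows "at_most_k_simple k P"
  unfolding at_most_k_simple_def
proof (intro allI impI, elim conjE)
  fix E assume E: "E face_of P" "E \<noteq> {}" "aff_dim E = aff_dim P - int k - 1"
  have "polytope E" using P E face_of_polytope_polytope by blast
  \<comment> \<open>By \<open>d\<close> the face \<open>E\<close> has dimension at least 1, so it
    has a facet; that facet has codimension \<open>k + 2\<close> in \<open>P\<close>, as
    \<open>s\<close> requires.\<close>
  then obtain E' where E': "E' facet_of E" using polytope_facet_exists[of E] E d by auto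
  then have "E' \<noteq> {}" "aff_dim E' = aff_dim P - int (Suc k) - 1" "E' face_of P" "E' \<subseteq> E"
    using E face_of_trans[of E' E P] facet_of_imp_subset[OF E'] by (simp_all add: facet_of_def)
  then have c: "card {G. G facet_of P \<and> E' \<subseteq> G} \<le> Suc k + 1"
    using s unfolding at_most_k_simple_def by blast
  have fin: "finite {G. G facet_of P \<and> E' \<subseteq> G}"
    using finite_polytope_facets[OF P] by (rule rev_finite_subset) auto
  \<comment> \<open>A nonempty proper face is the intersection of the facets containing it, so equal
    families would give \<open>E = E'\<close>.\<close>
  have "{G. G facet_of P \<and> E \<subseteq> G} \<noteq> {G. G facet_of P \<and> E' \<subseteq> G}"
  proof
    assume eq: "{G. G facet_of P \<and> E \<subseteq> G} = {G. G facet_of P \<and> E' \<subseteq> G}"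
    have ne: "E \<noteq> P" "E' \<noteq> P" using E \<open>aff_dim E' = _\<close> by auto
    have "E = \<Inter>{G. G facet_of P \<and> E \<subseteq> G}"
      by (rule face_of_polyhedron[OF polytope_imp_polyhedron[OF P] E(1,2) ne(1)])
    also have "\<dots> = \<Inter>{G. G facet_of P \<and> E' \<subseteq> G}" by (simp only: eq)
    also have "\<dots> = E'"
      by (rule face_of_polyhedron[OF polytope_imp_polyhedron[OF P] \<open>E' face_of P\<close> \<open>E' \<noteq> {}\<close> ne(2), symmetric])
    finally show False using E' by simp
  qed
  then have "{G. G facet_of P \<and> E \<subseteq> G} \<subset> {G. G facet_of P \<and> E' \<subseteq> G}"
    using \<open>E' \<subseteq> E\<close> by blast
  then have "card {G. G facet_of P \<and> E \<subseteq> G} < card {G. G facet_of P \<and> E' \<subseteq> G}"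
    by (rule psubset_card_mono[OF fin])
  then show "card {G. G facet_of P \<and> E \<subseteq> G} \<le> k + 1" using c by linarith
qed

lemma at_most_k_simple_mono:
  assumes "polytope P" "at_most_k_simple k P" "j \<le> k" "int k + 1 \<le> aff_dim P"
  shows "at_most_k_simple j P"
  using assms(3,2,4)
proof (induction rule: dec_induct)
  case (step n)
  then show ?case using at_most_k_simple_pred[OF assms(1), of n] by simp
qed

section \<open>From the facets to the whole polytope\<close>

text \<open>Besides \<open>F \<inter> G1\<close>, the facet \<open>G1\<close> has a second ridge
  \<open>S\<close> through the common face of codimension 3. The facet of \<open>P\<close> across
  \<open>S\<close> contains that face too and, as at most three facets do, it is \<open>G2\<close>.
  So \<open>G1 \<inter> G2 = S\<close>, which is not inside \<open>F\<close> and has a vertex off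
  \<open>F\<close>.\<close>

lemma vertex_off_facet:
  assumes P: "polytope P" and s: "at_most_k_simple 2 P"
    and F: "F facet_of P" and G1: "G1 facet_of P" and G2: "G2 facet_of P"
    and R1: "F \<inter> G1 facet_of F" and R2: "F \<inter> G2 facet_of F"
    and E: "(F \<inter> G1) \<inter> (F \<inter> G2) facet_of F \<inter> G1"
  obtains v where "v extreme_point_of G1" "v extreme_point_of G2" "v \<notin> F"
proof -
  let ?E = "(F \<inter> G1) \<inter> (F \<inter> G2)"
  have poly: "polyhedron P" "polyhedron G1" "convex G1"
    using P G1 face_of_polytope_polytope facet_of_imp_face_of polytope_imp_polyhedron
      polytope_imp_convex by blast+
  have R1': "F \<inter> G1 facet_of G1" using ridge_facet_swap F G1 R1 by blast
  obtain S where S: "S facet_of G1" "S \<noteq> F \<inter> G1" "(F \<inter> G1) \<inter> S = ?E"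
    using ridge_other_facet[OF poly(2) R1' E] .
  obtain H where H: "H facet_of P" "H \<noteq> G1" "G1 \<inter> H = S"
    using ridge_other_facet[OF poly(1) G1 S(1)] .
  have "H = G2"
  proof (rule ccontr)
    assume "H \<noteq> G2"
    moreover have "F \<noteq> G1" "F \<noteq> G2" using R1 R2 by auto
    moreover have "G1 \<noteq> G2" using E by auto
    moreover have "H \<noteq> F" using H S by blast
    ultimately have "card {F, G1, G2, H} = 4" using H by auto
    moreover have "{F, G1, G2, H} \<subseteq> {G. G facet_of P \<and> ?E \<subseteq> G}"
      using F G1 G2 H S by blast
    moreover have "finite {G. G facet_of P \<and> ?E \<subseteq> G}"
      using finite_polytope_facets[OF P] by (rule rev_finite_subset) auto
    ultimately have "4 \<le> card {G. G facet_of P \<and> ?E \<subseteq> G}" by (metis card_mono)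
    moreover have "?E face_of P"
      using F G1 G2 by (intro face_of_Int) (auto simp: facet_of_def)
    moreover have "?E \<noteq> {}" "aff_dim ?E = aff_dim P - int 2 - 1"
      using E R1 F by (simp_all add: facet_of_def)
    ultimately show False using s unfolding at_most_k_simple_def by fastforce
  qed
  then have S12: "G1 \<inter> G2 = S" using H by simp
  have "\<not> S \<subseteq> F"
  proof
    assume "S \<subseteq> F"
    then have "S \<subseteq> F \<inter> G1" using S12 by blast
    then show False using facet_subset_eq[OF poly(3) S(1) R1'] S by blast
  qed
  moreover have "S face_of G1" using S(1) by (rule facet_of_imp_face_of)
  moreover have "S face_of G2"
    using ridge_facet_swap[OF G1 G2] S(1) S12 by (simp add: facet_of_imp_face_of)
  moreover have "polytope S"
    using P G1 \<open>S face_of G1\<close> by (meson face_of_polytope_polytope facet_of_imp_face_of)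
  moreover have "convex F" using F facet_of_imp_face_of face_of_imp_convex by blast
  ultimately obtain v where "v extreme_point_of S" "v \<notin> F"
    using polytope_subset_if_vertices[of S F] by blast
  then show thesis
    using that \<open>S face_of G1\<close> \<open>S face_of G2\<close> extreme_point_of_face by blast
qed

text \<open>Starting at \<open>F \<inter> G\<close>, the multiple \<open>t\<close> is carried
  between adjacent ridges in the boundary of \<open>F\<close>, where \<open>facets_connected\<close>
  reaches them all. A common vertex off \<open>F\<close> forces each new multiple to be
  \<open>t\<close> again.\<close>

lemma adjacent_multiples_equal:
  assumes P: "polytope P" and d: "3 \<le> aff_dim P" and s: "at_most_k_simple 2 P"
    and q: "\<And>G. G facet_of P \<Longrightarrow> affine_on_vertices q G"
    and F: "F facet_of P" and a: "F = P \<inter> {x. a \<bullet> x = b}"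
    and q0: "\<And>v. v extreme_point_of F \<Longrightarrow> q v = 0"
    and G: "G facet_of P" "F \<inter> G facet_of F"
    and qG: "\<And>v. v extreme_point_of G \<Longrightarrow> q v = t * (b - a \<bullet> v)"
    and H: "H facet_of P" "F \<inter> H facet_of F" "v extreme_point_of H"
  shows "q v = t * (b - a \<bullet> v)"
proof -
  define W where "W = {R. R facet_of F \<and> (\<forall>G v. G facet_of P \<longrightarrow> F \<inter> G = R \<longrightarrow>
    v extreme_point_of G \<longrightarrow> q v = t * (b - a \<bullet> v))}"
  have pP: "polyhedron P" using P polytope_imp_polyhedron by blast
  have "F \<inter> H \<in> W"
  proof (rule facets_connected[of F W])
    show "polytope F" using P F face_of_polytope_polytope facet_of_imp_face_of by blast
    show "2 \<le> aff_dim F" using F d by (auto simp: facet_of_def)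
    \<comment> \<open>Only one facet lies across a ridge, so the quantifier in \<open>W\<close>
      reduces to \<open>G\<close>.\<close>
    have "F \<inter> G \<in> W"
      using ridge_facets_unique[OF pP F G(1) _ G(2)] qG G unfolding W_def by blast
    then show "W \<noteq> {}" by blast
    show "R facet_of F" if "R \<in> W" for R using that by (simp add: W_def)
    fix R R' assume R: "R \<in> W" "R' facet_of F" "R \<inter> R' facet_of R"
    obtain G' where G': "G' facet_of P" "F \<inter> G' = R"
      using ridge_other_facet[OF pP F] R(1) unfolding W_def by blast
    have qG': "q v = t * (b - a \<bullet> v)" if "v extreme_point_of G'" for v
      using R(1) G' that unfolding W_def by blast
    show "R' \<in> W" unfolding W_def
    proof (intro CollectI conjI allI impI R(2))
      fix K v assume K: "K facet_of P" "F \<inter> K = R'" "v extreme_point_of K"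
      obtain t' where t': "\<And>v. v extreme_point_of K \<Longrightarrow> q v = t' * (b - a \<bullet> v)"
        using adjacent_multiple[OF P F K(1) _ a q0 q[OF K(1)]] K R by blast
      obtain u where u: "u extreme_point_of G'" "u extreme_point_of K" "u \<notin> F"
        by (rule vertex_off_facet[OF P s F G'(1) K(1)]) (use G' K R in \<open>auto simp: W_def\<close>)
      have "u \<in> P" using u K facet_of_imp_subset by (auto simp: extreme_point_of_def)
      then have "b - a \<bullet> u \<noteq> 0" using u a by auto
      then have "t' = t" using t'[OF u(2)] qG'[OF u(1)] by simp
      then show "q v = t * (b - a \<bullet> v)" using t' K by blast
    qed
  qed (use H in auto)
  then show ?thesis using H unfolding W_def by blast
qed

lemma affine_on_vertices_if_facets:
  assumes P: "polytope P" and d: "3 \<le> aff_dim P" and s: "at_most_k_simple 2 P"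
    and q: "\<And>G. G facet_of P \<Longrightarrow> affine_on_vertices q G"
  shows "affine_on_vertices q P"
proof -
  have pP: "polyhedron P" using P polytope_imp_polyhedron by blast
  obtain F where F: "F facet_of P" using polytope_facet_exists[OF P] d by auto
  have "polytope F" using P F face_of_polytope_polytope facet_of_imp_face_of by blast
  then obtain R where R: "R facet_of F"
    using polytope_facet_exists[of F] d F by (auto simp: facet_of_def)
  obtain G where G: "G facet_of P" "F \<inter> G = R" using ridge_other_facet[OF pP F R] by blast
  obtain c e where ce: "\<And>v. v extreme_point_of F \<Longrightarrow> q v = c \<bullet> v + e"
    using q[OF F] unfolding affine_on_vertices_def by blast
  obtain a b where a: "F = P \<inter> {x. a \<bullet> x = b}" using facet_of_polyhedron[OF pP F] by metis
  \<comment> \<open>First normalisation: \<open>q1\<close> vanishes on the vertices of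
    \<open>F\<close>.\<close>
  define q1 where "q1 v = q v - (c \<bullet> v + e)" for v
  have q1: "affine_on_vertices q1 K" if "K facet_of P" for K
    using affine_on_vertices_diff[OF q[OF that], of c e] by (simp add: q1_def[abs_def])
  have q1F: "q1 v = 0" if "v extreme_point_of F" for v using ce[OF that] by (simp add: q1_def)
  obtain t where t: "\<And>v. v extreme_point_of G \<Longrightarrow> q1 v = t * (b - a \<bullet> v)"
    using adjacent_multiple[OF P F G(1) _ a q1F q1[OF G(1)]] G R by blast
  have adj: "q1 v = t * (b - a \<bullet> v)"
    if "K facet_of P" "F \<inter> K facet_of F" "v extreme_point_of K" for K v
    by (rule adjacent_multiples_equal[OF P d s q1 F a q1F G(1) _ t that]) (use G R in auto)
  \<comment> \<open>The correction \<open>t * (b - a \<bullet> v)\<close> is zero on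
    \<open>F\<close> and equals \<open>q1\<close> on the vertices of its neighbours, so
    \<open>q2\<close> vanishes on all of these.\<close>
  define q2 where "q2 v = q1 v - ((- t *\<^sub>R a) \<bullet> v + t * b)" for v
  have q2: "affine_on_vertices q2 K" if "K facet_of P" for K
    using affine_on_vertices_diff[OF q1[OF that], of "- t *\<^sub>R a" "t * b"] by (simp add: q2_def[abs_def])
  define Z where "Z = {K. K facet_of P \<and> (\<forall>v. v extreme_point_of K \<longrightarrow> q2 v = 0)}"
  \<comment> \<open>Vanishing on the neighbours belongs to the propagated property: one neighbour
    with multiple 0 is what fixes the common multiple at the next facet.\<close>
  define W where "W = {K \<in> Z. \<forall>L. L facet_of P \<longrightarrow> K \<inter> L facet_of K \<longrightarrow> L \<in> Z}"
  have q2F: "q2 v = 0" if v: "v extreme_point_of F" for v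
  proof -
    have "a \<bullet> v = b" using v a by (auto simp: extreme_point_of_def)
    then show ?thesis using q1F[OF v] by (simp add: q2_def)
  qed
  have all: "K \<in> W" if K: "K facet_of P" for K
  proof (rule facets_connected[OF P, of W])
    have "F \<in> W"
      using F q2F adj unfolding W_def Z_def by (auto simp: q2_def algebra_simps)
    then show "W \<noteq> {}" by blast
    fix K L assume K: "K \<in> W" and L: "L facet_of P" "K \<inter> L facet_of K"
    have Kf: "K facet_of P" and K0: "\<And>v. v extreme_point_of K \<Longrightarrow> q2 v = 0"
      using K by (auto simp: W_def Z_def)
    have LZ: "L \<in> Z" using K L by (auto simp: W_def)
    then have L0: "\<And>v. v extreme_point_of L \<Longrightarrow> q2 v = 0" by (auto simp: Z_def)
    obtain a' b' where a': "L = P \<inter> {x. a' \<bullet> x = b'}" using facet_of_polyhedron[OF pP L(1)] by metis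
    have LK: "L \<inter> K facet_of L" using ridge_facet_swap[OF Kf L] by (simp add: Int_commute)
    \<comment> \<open>Seen from \<open>L\<close>, the neighbour \<open>K\<close> has multiple 0,
      hence so has every neighbour of \<open>L\<close>.\<close>
    have "q2 v = 0" if M: "M facet_of P" "L \<inter> M facet_of L" "v extreme_point_of M" for M v
      using adjacent_multiples_equal[OF P d s q2 L(1) a' L0 Kf LK _ M, of 0] K0 by simp
    then show "L \<in> W" using LZ by (auto simp: W_def Z_def)
  qed (use K d in \<open>auto simp: W_def Z_def\<close>)
  \<comment> \<open>Every vertex of \<open>P\<close> lies on a facet; undoing the two subtractions
    gives a single affine function for \<open>q\<close>.\<close>
  have "q v = (c - t *\<^sub>R a) \<bullet> v + (e + t * b)" if v: "v extreme_point_of P" for v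
  proof -
    have "{v} face_of P" using v by (simp add: face_of_singleton)
    moreover have "{v} \<noteq> P" using d by auto
    ultimately obtain K where K: "K facet_of P" "v \<in> K"
      using face_of_polyhedron_subset_facet[OF pP] by blast
    then have "v extreme_point_of K" using v extreme_point_of_face facet_of_imp_face_of by blast
    then have "q2 v = 0" using all[OF K(1)] by (auto simp: W_def Z_def)
    then show ?thesis by (simp add: q2_def q1_def inner_diff_left)
  qed
  then show ?thesis unfolding affine_on_vertices_def by blast
qed

section \<open>Induction on k and the characterisation\<close>

text \<open>Passing to a facet lowers both the dimension and \<open>k\<close> by one, so the
  dimension of the faces assumed inscribed stays the same. Induction makes all facets inscribed, and
  the facets determine \<open>P\<close>.\<close>

lemma inscribed_if_faces_inscribed:
  assumes "1 \<le> k" "polytope P" "int k + 1 \<le> aff_dim P" "at_most_k_simple k P"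
    and "\<And>F. F face_of P \<Longrightarrow> aff_dim F = aff_dim P - int k + 1 \<Longrightarrow> inscribed F"
  shows "inscribed P"
  using assms
proof (induction k arbitrary: P rule: nat_induct_at_least)
  case base
  \<comment> \<open>For \<open>k = 1\<close> the prescribed dimension is that of \<open>P\<close>,
    so \<open>P\<close> is itself one of the given faces.\<close>
  then show ?case using face_of_refl[of P] polytope_imp_convex by auto
next
  case (Suc k)
  note P = Suc.prems(1)
  have "affine_on_vertices (\<lambda>v. v \<bullet> v) F" if F: "F facet_of P" for F
    unfolding inscribed_iff_affine_on_vertices[symmetric]
  proof (rule Suc.IH)
    show "polytope F" using P F face_of_polytope_polytope facet_of_imp_face_of by blast
    show "int k + 1 \<le> aff_dim F" using Suc.prems F by (auto simp: facet_of_def)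
    show "at_most_k_simple k F" using at_most_k_simple_facet P Suc.prems(3) F by blast
    fix E assume "E face_of F" "aff_dim E = aff_dim F - int k + 1"
    then show "inscribed E"
      using F by (intro Suc.prems(4)) (auto simp: facet_of_def intro: face_of_trans)
  qed
  moreover have "at_most_k_simple 2 P"
    using at_most_k_simple_mono[OF P Suc.prems(3)] Suc.prems(2) Suc.hyps by auto
  ultimately show ?case
    using affine_on_vertices_if_facets[OF P] Suc.prems(2) Suc.hyps inscribed_iff_affine_on_vertices
    by auto
qed

theorem theorem4p10:
  fixes P :: "'a::euclidean_space set" and d k :: nat
  assumes "polytope P" and "aff_dim P = int d"
    and "k_simple k P" and "1 \<le> k" and "k \<le> d - 1"
  shows "inscribed P \<longleftrightarrow>
         (\<forall>F. F face_of P \<and> aff_dim F = int d - int k + 1 \<longrightarrow> inscribed F)"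
proof
  assume "inscribed P"
  then show "\<forall>F. F face_of P \<and> aff_dim F = int d - int k + 1 \<longrightarrow> inscribed F"
    using affine_on_vertices_face by (auto simp: inscribed_iff_affine_on_vertices)
next
  assume R: "\<forall>F. F face_of P \<and> aff_dim F = int d - int k + 1 \<longrightarrow> inscribed F"
  have "at_most_k_simple k P"
    using assms(3) by (auto simp: k_simple_def at_most_k_simple_def)
  \<comment> \<open>The subtraction \<open>d - 1\<close> is truncated; \<open>1 \<le> k\<close>
    rules out \<open>d = 0\<close>.\<close>
  moreover have "int k + 1 \<le> aff_dim P" using assms(2,4,5) by linarith
  ultimately show "inscribed P"
    using inscribed_if_faces_inscribed[OF assms(4,1)] R assms(2) by auto
qed

end
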